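(* Let $T$ be a ternary $\Gamma$-semiring, $M$ a ternary $\Gamma$-semimodule over $T$, $\equiv$ a congruence on $M$, and $q:M\to M/{\equiv}$ the quotient map. Then the kernel pair of $q$ in $\mathsf{SMod}_{T,\Gamma}$ is exactly the relation $\equiv$. Equivalently, $\equiv$ is effective.
   Context: Fix a commutative monoid $(\Gamma,+,0_\Gamma)$. A ternary $\Gamma$-semiring is a commutative monoid $(T,+,0)$ with a map $T\times\Gamma\times T\times\Gamma\times T\to T$, $(a,\alpha,b,\beta,c)\mapsto a\alpha b\beta c$, that is additive in each of the five slots separately, satisfies ternary associativity $(a\alpha b\beta c)\gamma d\delta e=a\alpha(b\beta c\gamma d)\delta e=a\alpha b\beta(c\gamma d\delta e)$ for all $a,b,c,d,e\in T$, $\alpha,\beta,\gamma,\delta\in\Gamma$, and satisfies $a\alpha b\beta c=0$ whenever one of $a,b,c$ is $0$ or one of $\alpha,\beta$ is $0_\Gamma$. A ternary $\Gamma$-semimodule over $T$ is a commutative monoid $(M,+,0)$ with a map $T\times\Gamma\times M\times\Gamma\times T\to M$, $(a,\alpha,m,\beta,b)\mapsto a\alpha m\beta b$, that is additive in each of the five slots separately, satisfies $a\alpha m\beta b=0$ whenever $a=0$ or $m=0$ or $b=0$ or $\alpha=0_\Gamma$ or $\beta=0_\Gamma$, and satisfies $(a\alpha b\beta c)\gamma m\delta d=a\alpha(b\beta m\gamma c)\delta d$ for all $a,b,c,d\in T$, $m\in M$, $\alpha,\beta,\gamma,\delta\in\Gamma$. A morphism $f:M\to N$ is a monoid morphism with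 $f(a\alpha m\beta b)=a\alpha f(m)\beta b$ for all $a,b\in T$, $\alpha,\beta\in\Gamma$, $m\in M$. The resulting category is $\mathsf{SMod}_{T,\Gamma}$. A congruence on a semimodule $M$ is an equivalence relation $\equiv$ such that $x\equiv y$ implies $x+z\equiv y+z$ for all $z\in M$ and $a\alpha x\beta b\equiv a\alpha y\beta b$ for all $a,b\in T$, $\alpha,\beta\in\Gamma$. The quotient set $M/{\equiv}$ is a semimodule with the induced operations. The kernel pair of $f:M\to N$ is the pullback $M\times_N M$ of $f$ along itself, regarded as a subobject of $M\times M$ (componentwise operations). A congruence $\equiv$, viewed as the subobject $\{(x,y)\mid x\equiv y\}$ of $M\times M$, is effective if it is the kernel pair of its coequalizer, i.e. of its quotient map. *)

theory Defs
  imports "HOL-Algebra.Group"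
begin

text \<open>
  Commutative monoids are the \<open>comm_monoid\<close>s of \<open>HOL-Algebra\<close>, written additively here;
  \<open>\<oplus>\<close> and \<open>\<zero>\<close> are the fields \<open>mult\<close> and \<open>one\<close> of the monoid record.
\<close>

abbreviation (input) add_op :: "('a, 'b) monoid_scheme \<Rightarrow> 'a \<Rightarrow> 'a \<Rightarrow> 'a" (infixl \<open>\<oplus>\<index>\<close> 65)
  where "add_op \<equiv> mult"

abbreviation (input) zero_el :: "('a, 'b) monoid_scheme \<Rightarrow> 'a" (\<open>\<zero>\<index>\<close>)
  where "zero_el \<equiv> one"

record ('t, 'g) tsemiring = "'t monoid" +
  tmul :: "'t \<Rightarrow> 'g \<Rightarrow> 't \<Rightarrow> 'g \<Rightarrow> 't \<Rightarrow> 't"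

record ('m, 't, 'g) tsemimodule = "'m monoid" +
  tact :: "'t \<Rightarrow> 'g \<Rightarrow> 'm \<Rightarrow> 'g \<Rightarrow> 't \<Rightarrow> 'm"

locale ternary_gamma_semiring =
  \<Gamma>: comm_monoid \<Gamma> + T: comm_monoid T
  for \<Gamma> :: "'g monoid" and T :: "('t, 'g) tsemiring" +
  assumes tmul_closed:
    "\<lbrakk>a \<in> carrier T; \<alpha> \<in> carrier \<Gamma>; b \<in> carrier T; \<beta> \<in> carrier \<Gamma>; c \<in> carrier T\<rbrakk>
      \<Longrightarrow> tmul T a \<alpha> b \<beta> c \<in> carrier T"
  and tmul_add1:
    "\<lbrakk>a \<in> carrier T; a' \<in> carrier T; \<alpha> \<in> carrier \<Gamma>; b \<in> carrier T; \<beta> \<in> carrier \<Gamma>; c \<in> carrier T\<rbrakk>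
      \<Longrightarrow> tmul T (a \<oplus>\<^bsub>T\<^esub> a') \<alpha> b \<beta> c = tmul T a \<alpha> b \<beta> c \<oplus>\<^bsub>T\<^esub> tmul T a' \<alpha> b \<beta> c"
  and tmul_add2:
    "\<lbrakk>a \<in> carrier T; \<alpha> \<in> carrier \<Gamma>; \<alpha>' \<in> carrier \<Gamma>; b \<in> carrier T; \<beta> \<in> carrier \<Gamma>; c \<in> carrier T\<rbrakk>
      \<Longrightarrow> tmul T a (\<alpha> \<oplus>\<^bsub>\<Gamma>\<^esub> \<alpha>') b \<beta> c = tmul T a \<alpha> b \<beta> c \<oplus>\<^bsub>T\<^esub> tmul T a \<alpha>' b \<beta> c"
  and tmul_add3:
    "\<lbrakk>a \<in> carrier T; \<alpha> \<in> carrier \<Gamma>; b \<in> carrier T; b' \<in> carrier T; \<beta> \<in> carrier \<Gamma>; c \<in> carrier T\<rbrakk>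
      \<Longrightarrow> tmul T a \<alpha> (b \<oplus>\<^bsub>T\<^esub> b') \<beta> c = tmul T a \<alpha> b \<beta> c \<oplus>\<^bsub>T\<^esub> tmul T a \<alpha> b' \<beta> c"
  and tmul_add4:
    "\<lbrakk>a \<in> carrier T; \<alpha> \<in> carrier \<Gamma>; b \<in> carrier T; \<beta> \<in> carrier \<Gamma>; \<beta>' \<in> carrier \<Gamma>; c \<in> carrier T\<rbrakk>
      \<Longrightarrow> tmul T a \<alpha> b (\<beta> \<oplus>\<^bsub>\<Gamma>\<^esub> \<beta>') c = tmul T a \<alpha> b \<beta> c \<oplus>\<^bsub>T\<^esub> tmul T a \<alpha> b \<beta>' c"
  and tmul_add5:
    "\<lbrakk>a \<in> carrier T; \<alpha> \<in> carrier \<Gamma>; b \<in> carrier T; \<beta> \<in> carrier \<Gamma>; c \<in> carrier T; c' \<in> carrier T\<rbrakk>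
      \<Longrightarrow> tmul T a \<alpha> b \<beta> (c \<oplus>\<^bsub>T\<^esub> c') = tmul T a \<alpha> b \<beta> c \<oplus>\<^bsub>T\<^esub> tmul T a \<alpha> b \<beta> c'"
  and tmul_assoc1:
    "\<lbrakk>a \<in> carrier T; b \<in> carrier T; c \<in> carrier T; d \<in> carrier T; e \<in> carrier T;
      \<alpha> \<in> carrier \<Gamma>; \<beta> \<in> carrier \<Gamma>; \<gamma> \<in> carrier \<Gamma>; \<delta> \<in> carrier \<Gamma>\<rbrakk>
      \<Longrightarrow> tmul T (tmul T a \<alpha> b \<beta> c) \<gamma> d \<delta> e = tmul T a \<alpha> (tmul T b \<beta> c \<gamma> d) \<delta> e"
  and tmul_assoc2:
    "\<lbrakk>a \<in> carrier T; b \<in> carrier T; c \<in> carrier T; d \<in> carrier T; e \<in> carrier T;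
      \<alpha> \<in> carrier \<Gamma>; \<beta> \<in> carrier \<Gamma>; \<gamma> \<in> carrier \<Gamma>; \<delta> \<in> carrier \<Gamma>\<rbrakk>
      \<Longrightarrow> tmul T a \<alpha> (tmul T b \<beta> c \<gamma> d) \<delta> e = tmul T a \<alpha> b \<beta> (tmul T c \<gamma> d \<delta> e)"
  and tmul_zero:
    "\<lbrakk>a \<in> carrier T; \<alpha> \<in> carrier \<Gamma>; b \<in> carrier T; \<beta> \<in> carrier \<Gamma>; c \<in> carrier T;
      a = \<zero>\<^bsub>T\<^esub> \<or> b = \<zero>\<^bsub>T\<^esub> \<or> c = \<zero>\<^bsub>T\<^esub> \<or> \<alpha> = \<zero>\<^bsub>\<Gamma>\<^esub> \<or> \<beta> = \<zero>\<^bsub>\<Gamma>\<^esub>\<rbrakk>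
      \<Longrightarrow> tmul T a \<alpha> b \<beta> c = \<zero>\<^bsub>T\<^esub>"

locale ternary_gamma_semimodule =
  ternary_gamma_semiring \<Gamma> T + M: comm_monoid M
  for \<Gamma> :: "'g monoid" and T :: "('t, 'g) tsemiring" and M :: "('m, 't, 'g) tsemimodule" +
  assumes tact_closed:
    "\<lbrakk>a \<in> carrier T; \<alpha> \<in> carrier \<Gamma>; m \<in> carrier M; \<beta> \<in> carrier \<Gamma>; b \<in> carrier T\<rbrakk>
      \<Longrightarrow> tact M a \<alpha> m \<beta> b \<in> carrier M"
  and tact_add1:
    "\<lbrakk>a \<in> carrier T; a' \<in> carrier T; \<alpha> \<in> carrier \<Gamma>; m \<in> carrier M; \<beta> \<in> carrier \<Gamma>; b \<in> carrier T\<rbrakk>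
      \<Longrightarrow> tact M (a \<oplus>\<^bsub>T\<^esub> a') \<alpha> m \<beta> b = tact M a \<alpha> m \<beta> b \<oplus>\<^bsub>M\<^esub> tact M a' \<alpha> m \<beta> b"
  and tact_add2:
    "\<lbrakk>a \<in> carrier T; \<alpha> \<in> carrier \<Gamma>; \<alpha>' \<in> carrier \<Gamma>; m \<in> carrier M; \<beta> \<in> carrier \<Gamma>; b \<in> carrier T\<rbrakk>
      \<Longrightarrow> tact M a (\<alpha> \<oplus>\<^bsub>\<Gamma>\<^esub> \<alpha>') m \<beta> b = tact M a \<alpha> m \<beta> b \<oplus>\<^bsub>M\<^esub> tact M a \<alpha>' m \<beta> b"
  and tact_add3:
    "\<lbrakk>a \<in> carrier T; \<alpha> \<in> carrier \<Gamma>; m \<in> carrier M; m' \<in> carrier M; \<beta> \<in> carrier \<Gamma>; b \<in> carrier T\<rbrakk>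
      \<Longrightarrow> tact M a \<alpha> (m \<oplus>\<^bsub>M\<^esub> m') \<beta> b = tact M a \<alpha> m \<beta> b \<oplus>\<^bsub>M\<^esub> tact M a \<alpha> m' \<beta> b"
  and tact_add4:
    "\<lbrakk>a \<in> carrier T; \<alpha> \<in> carrier \<Gamma>; m \<in> carrier M; \<beta> \<in> carrier \<Gamma>; \<beta>' \<in> carrier \<Gamma>; b \<in> carrier T\<rbrakk>
      \<Longrightarrow> tact M a \<alpha> m (\<beta> \<oplus>\<^bsub>\<Gamma>\<^esub> \<beta>') b = tact M a \<alpha> m \<beta> b \<oplus>\<^bsub>M\<^esub> tact M a \<alpha> m \<beta>' b"
  and tact_add5:
    "\<lbrakk>a \<in> carrier T; \<alpha> \<in> carrier \<Gamma>; m \<in> carrier M; \<beta> \<in> carrier \<Gamma>; b \<in> carrier T; b' \<in> carrier T\<rbrakk>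
      \<Longrightarrow> tact M a \<alpha> m \<beta> (b \<oplus>\<^bsub>T\<^esub> b') = tact M a \<alpha> m \<beta> b \<oplus>\<^bsub>M\<^esub> tact M a \<alpha> m \<beta> b'"
  and tact_zero:
    "\<lbrakk>a \<in> carrier T; \<alpha> \<in> carrier \<Gamma>; m \<in> carrier M; \<beta> \<in> carrier \<Gamma>; b \<in> carrier T;
      a = \<zero>\<^bsub>T\<^esub> \<or> m = \<zero>\<^bsub>M\<^esub> \<or> b = \<zero>\<^bsub>T\<^esub> \<or> \<alpha> = \<zero>\<^bsub>\<Gamma>\<^esub> \<or> \<beta> = \<zero>\<^bsub>\<Gamma>\<^esub>\<rbrakk>
      \<Longrightarrow> tact M a \<alpha> m \<beta> b = \<zero>\<^bsub>M\<^esub>"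
  and tact_assoc:
    "\<lbrakk>a \<in> carrier T; b \<in> carrier T; c \<in> carrier T; d \<in> carrier T; m \<in> carrier M;
      \<alpha> \<in> carrier \<Gamma>; \<beta> \<in> carrier \<Gamma>; \<gamma> \<in> carrier \<Gamma>; \<delta> \<in> carrier \<Gamma>\<rbrakk>
      \<Longrightarrow> tact M (tmul T a \<alpha> b \<beta> c) \<gamma> m \<delta> d = tact M a \<alpha> (tact M b \<beta> m \<gamma> c) \<delta> d"

text \<open>
  Morphisms are extensional functions, so that equality of morphisms is equality of functions;
  \<open>compose A g f\<close> is the composite of \<open>f\<close> with domain \<open>A\<close> followed by \<open>g\<close>.
\<close>

definition smod_hom ::
  "'g monoid \<Rightarrow> ('t, 'g) tsemiring \<Rightarrow> ('m, 't, 'g) tsemimodule \<Rightarrow> ('n, 't, 'g) tsemimodule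
    \<Rightarrow> ('m \<Rightarrow> 'n) set"
  where "smod_hom \<Gamma> T M N =
    {f \<in> hom M N. f \<in> extensional (carrier M) \<and> f \<zero>\<^bsub>M\<^esub> = \<zero>\<^bsub>N\<^esub> \<and>
      (\<forall>a\<in>carrier T. \<forall>\<alpha>\<in>carrier \<Gamma>. \<forall>m\<in>carrier M. \<forall>\<beta>\<in>carrier \<Gamma>. \<forall>b\<in>carrier T.
        f (tact M a \<alpha> m \<beta> b) = tact N a \<alpha> (f m) \<beta> b)}"

definition smod_congruence ::
  "'g monoid \<Rightarrow> ('t, 'g) tsemiring \<Rightarrow> ('m, 't, 'g) tsemimodule \<Rightarrow> ('m \<times> 'm) set \<Rightarrow> bool"
  where "smod_congruence \<Gamma> T M R \<longleftrightarrow>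
    equiv (carrier M) R \<and>
    (\<forall>x y. (x, y) \<in> R \<longrightarrow>
      (\<forall>z\<in>carrier M. (x \<oplus>\<^bsub>M\<^esub> z, y \<oplus>\<^bsub>M\<^esub> z) \<in> R) \<and>
      (\<forall>a\<in>carrier T. \<forall>\<alpha>\<in>carrier \<Gamma>. \<forall>\<beta>\<in>carrier \<Gamma>. \<forall>b\<in>carrier T.
        (tact M a \<alpha> x \<beta> b, tact M a \<alpha> y \<beta> b) \<in> R))"

text \<open>
  The induced operations are written, as usual for \<open>equiv\<close>, as a union over all
  representatives; for a congruence this union is a single class.
\<close>

definition smod_quot ::
  "('m, 't, 'g) tsemimodule \<Rightarrow> ('m \<times> 'm) set \<Rightarrow> ('m set, 't, 'g) tsemimodule"
  where "smod_quot M R =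
    \<lparr>carrier = carrier M // R,
     mult = (\<lambda>X Y. \<Union>x\<in>X. \<Union>y\<in>Y. R `` {x \<oplus>\<^bsub>M\<^esub> y}),
     one = R `` {\<zero>\<^bsub>M\<^esub>},
     tact = (\<lambda>a \<alpha> X \<beta> b. \<Union>x\<in>X. R `` {tact M a \<alpha> x \<beta> b})\<rparr>"

definition quot_map :: "('m, 't, 'g) tsemimodule \<Rightarrow> ('m \<times> 'm) set \<Rightarrow> 'm \<Rightarrow> 'm set"
  where "quot_map M R = (\<lambda>x\<in>carrier M. R `` {x})"

definition smod_prod ::
  "('m, 't, 'g) tsemimodule \<Rightarrow> ('n, 't, 'g) tsemimodule \<Rightarrow> ('m \<times> 'n, 't, 'g) tsemimodule"
  where "smod_prod M N =
    \<lparr>carrier = carrier M \<times> carrier N,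
     mult = (\<lambda>(x, y) (x', y'). (x \<oplus>\<^bsub>M\<^esub> x', y \<oplus>\<^bsub>N\<^esub> y')),
     one = (\<zero>\<^bsub>M\<^esub>, \<zero>\<^bsub>N\<^esub>),
     tact = (\<lambda>a \<alpha> (x, y) \<beta> b. (tact M a \<alpha> x \<beta> b, tact N a \<alpha> y \<beta> b))\<rparr>"

text \<open>A relation on \<open>M\<close>, viewed as a subobject of \<open>M \<times> M\<close>.\<close>

definition rel_smod ::
  "('m, 't, 'g) tsemimodule \<Rightarrow> ('m \<times> 'm) set \<Rightarrow> ('m \<times> 'm, 't, 'g) tsemimodule"
  where "rel_smod M R = (smod_prod M M)\<lparr>carrier := R\<rparr>"

definition kernel_pair ::
  "('m, 't, 'g) tsemimodule \<Rightarrow> ('m \<Rightarrow> 'n) \<Rightarrow> ('m \<times> 'm, 't, 'g) tsemimodule"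
  where "kernel_pair M f =
    (smod_prod M M)\<lparr>carrier := {(x, y) \<in> carrier M \<times> carrier M. f x = f y}\<rparr>"

definition proj1 :: "('m \<times> 'n, 't, 'g) tsemimodule \<Rightarrow> 'm \<times> 'n \<Rightarrow> 'm"
  where "proj1 P = restrict fst (carrier P)"

definition proj2 :: "('m \<times> 'n, 't, 'g) tsemimodule \<Rightarrow> 'm \<times> 'n \<Rightarrow> 'n"
  where "proj2 P = restrict snd (carrier P)"

text \<open>
  Universal properties in the category of semimodules. HOL cannot quantify over types inside a
  formula, so the type of the elements of the test objects is an explicit parameter; a theorem
  with this parameter left as a type variable holds for test objects over every type.
\<close>

definition is_pullback ::
  "'x itself \<Rightarrow> 'g monoid \<Rightarrow> ('t, 'g) tsemiring
    \<Rightarrow> ('a, 't, 'g) tsemimodule \<Rightarrow> ('b, 't, 'g) tsemimodule \<Rightarrow> ('c, 't, 'g) tsemimodule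
    \<Rightarrow> ('a \<Rightarrow> 'c) \<Rightarrow> ('b \<Rightarrow> 'c)
    \<Rightarrow> ('p, 't, 'g) tsemimodule \<Rightarrow> ('p \<Rightarrow> 'a) \<Rightarrow> ('p \<Rightarrow> 'b) \<Rightarrow> bool"
  where "is_pullback TX \<Gamma> T A B C f g P p1 p2 \<longleftrightarrow>
    ternary_gamma_semimodule \<Gamma> T A \<and> ternary_gamma_semimodule \<Gamma> T B \<and>
    ternary_gamma_semimodule \<Gamma> T C \<and> ternary_gamma_semimodule \<Gamma> T P \<and>
    f \<in> smod_hom \<Gamma> T A C \<and> g \<in> smod_hom \<Gamma> T B C \<and>
    p1 \<in> smod_hom \<Gamma> T P A \<and> p2 \<in> smod_hom \<Gamma> T P B \<and>
    compose (carrier P) f p1 = compose (carrier P) g p2 \<and>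
    (\<forall>(X :: ('x, 't, 'g) tsemimodule) u v.
      ternary_gamma_semimodule \<Gamma> T X \<and> u \<in> smod_hom \<Gamma> T X A \<and> v \<in> smod_hom \<Gamma> T X B \<and>
      compose (carrier X) f u = compose (carrier X) g v \<longrightarrow>
      (\<exists>!h. h \<in> smod_hom \<Gamma> T X P \<and>
        compose (carrier X) p1 h = u \<and> compose (carrier X) p2 h = v))"

definition is_coequalizer ::
  "'x itself \<Rightarrow> 'g monoid \<Rightarrow> ('t, 'g) tsemiring
    \<Rightarrow> ('a, 't, 'g) tsemimodule \<Rightarrow> ('b, 't, 'g) tsemimodule \<Rightarrow> ('a \<Rightarrow> 'b) \<Rightarrow> ('a \<Rightarrow> 'b)
    \<Rightarrow> ('q, 't, 'g) tsemimodule \<Rightarrow> ('b \<Rightarrow> 'q) \<Rightarrow> bool"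
  where "is_coequalizer TX \<Gamma> T A B u v Q e \<longleftrightarrow>
    ternary_gamma_semimodule \<Gamma> T A \<and> ternary_gamma_semimodule \<Gamma> T B \<and>
    ternary_gamma_semimodule \<Gamma> T Q \<and>
    u \<in> smod_hom \<Gamma> T A B \<and> v \<in> smod_hom \<Gamma> T A B \<and> e \<in> smod_hom \<Gamma> T B Q \<and>
    compose (carrier A) e u = compose (carrier A) e v \<and>
    (\<forall>(X :: ('x, 't, 'g) tsemimodule) h.
      ternary_gamma_semimodule \<Gamma> T X \<and> h \<in> smod_hom \<Gamma> T B X \<and>
      compose (carrier A) h u = compose (carrier A) h v \<longrightarrow>
      (\<exists>!k. k \<in> smod_hom \<Gamma> T Q X \<and> compose (carrier B) k e = h))"

definition is_kernel_pair ::
  "'x itself \<Rightarrow> 'g monoid \<Rightarrow> ('t, 'g) tsemiring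
    \<Rightarrow> ('m, 't, 'g) tsemimodule \<Rightarrow> ('n, 't, 'g) tsemimodule \<Rightarrow> ('m \<Rightarrow> 'n)
    \<Rightarrow> ('m \<times> 'm, 't, 'g) tsemimodule \<Rightarrow> bool"
  where "is_kernel_pair TX \<Gamma> T M N f K \<longleftrightarrow>
    is_pullback TX \<Gamma> T M M N f f K (proj1 K) (proj2 K)"

definition effective ::
  "'x itself \<Rightarrow> 'y itself \<Rightarrow> 'g monoid \<Rightarrow> ('t, 'g) tsemiring
    \<Rightarrow> ('m, 't, 'g) tsemimodule \<Rightarrow> ('m \<times> 'm) set \<Rightarrow> bool"
  where "effective TX TY \<Gamma> T M R \<longleftrightarrow>
    smod_congruence \<Gamma> T M R \<and>
    is_coequalizer TX \<Gamma> T (rel_smod M R) M (proj1 (rel_smod M R)) (proj2 (rel_smod M R))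
      (smod_quot M R) (quot_map M R) \<and>
    is_kernel_pair TY \<Gamma> T M (smod_quot M R) (quot_map M R) (rel_smod M R)"

end

theory Submission
  imports Defs
begin

text \<open>Two elements have the same class exactly when they are related, so the pairs identified
  by the quotient map are the elements of the congruence (\<open>kernel_pair_quot_map\<close>). Both
  objects carry the operations of \<open>smod_prod M M\<close>, hence they agree as semimodules and
  not only up to isomorphism. What remains is that these concrete objects have the required
  universal properties. Pullbacks are computed on underlying sets: a pair of maps equalized by
  \<open>f\<close> is the same as one map into the set of pairs with equal image
  (\<open>kernel_pair_is_kernel_pair\<close>). Dually, a morphism equalizes the two projections of
  \<open>R\<close> exactly when it is constant on classes, and then it factors uniquely through the
  surjection onto the quotient (\<open>quot_map_coequalizer\<close>). Effectiveness combines these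
  three facts.\<close>

section \<open>Morphisms and extensional functions\<close>

lemma smod_homI:
  assumes "\<And>x. x \<in> carrier M \<Longrightarrow> f x \<in> carrier N"
    and "\<And>x y. \<lbrakk>x \<in> carrier M; y \<in> carrier M\<rbrakk> \<Longrightarrow> f (x \<oplus>\<^bsub>M\<^esub> y) = f x \<oplus>\<^bsub>N\<^esub> f y"
    and "f \<in> extensional (carrier M)"
    and "f \<zero>\<^bsub>M\<^esub> = \<zero>\<^bsub>N\<^esub>"
    and "\<And>a \<alpha> m \<beta> b. \<lbrakk>a \<in> carrier T; \<alpha> \<in> carrier \<Gamma>; m \<in> carrier M; \<beta> \<in> carrier \<Gamma>; b \<in> carrier T\<rbrakk>
      \<Longrightarrow> f (tact M a \<alpha> m \<beta> b) = tact N a \<alpha> (f m) \<beta> b"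
  shows "f \<in> smod_hom \<Gamma> T M N"
  using assms by (auto simp: smod_hom_def hom_def)

lemma smod_homD:
  assumes "f \<in> smod_hom \<Gamma> T M N"
  shows "x \<in> carrier M \<Longrightarrow> f x \<in> carrier N"
    and "\<lbrakk>x \<in> carrier M; y \<in> carrier M\<rbrakk> \<Longrightarrow> f (x \<oplus>\<^bsub>M\<^esub> y) = f x \<oplus>\<^bsub>N\<^esub> f y"
    and "f \<in> extensional (carrier M)"
    and "f \<zero>\<^bsub>M\<^esub> = \<zero>\<^bsub>N\<^esub>"
    and "\<lbrakk>a \<in> carrier T; \<alpha> \<in> carrier \<Gamma>; x \<in> carrier M; \<beta> \<in> carrier \<Gamma>; b \<in> carrier T\<rbrakk>
      \<Longrightarrow> f (tact M a \<alpha> x \<beta> b) = tact N a \<alpha> (f x) \<beta> b"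
  using assms by (auto simp: smod_hom_def hom_def)

text \<open>Outside \<open>A\<close> both functions are \<open>undefined\<close>, so only values on
  \<open>A\<close> matter. This turns commuting triangles into pointwise equations.\<close>

lemma compose_eq_iff:
  assumes "h \<in> extensional A"
  shows "compose A g f = h \<longleftrightarrow> (\<forall>x\<in>A. g (f x) = h x)"
proof
  show "compose A g f = h" if "\<forall>x\<in>A. g (f x) = h x"
    using that by (intro extensionalityI[OF compose_extensional assms]) (simp add: compose_eq)
qed (auto simp: compose_eq)

lemma compose_eq_compose_iff:
  "compose A g f = compose A g' f' \<longleftrightarrow> (\<forall>x\<in>A. g (f x) = g' (f' x))"
  by (simp add: compose_eq_iff[OF compose_extensional] compose_eq)

section \<open>Products, subsemimodules and kernel pairs\<close>

lemma smod_prod_semimodule: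
  assumes "ternary_gamma_semimodule \<Gamma> T M" and "ternary_gamma_semimodule \<Gamma> T N"
  shows "ternary_gamma_semimodule \<Gamma> T (smod_prod M N)"
proof -
  interpret M: ternary_gamma_semimodule \<Gamma> T M by fact
  interpret N: ternary_gamma_semimodule \<Gamma> T N by fact
  have "comm_monoid (smod_prod M N)"
    by (rule comm_monoidI)
      (auto simp: smod_prod_def M.M.m_ac N.M.m_ac)
  then show ?thesis
    by (intro ternary_gamma_semimodule.intro ternary_gamma_semimodule_axioms.intro
        M.ternary_gamma_semiring_axioms)
      (auto simp: smod_prod_def
        M.tact_closed M.tact_add1 M.tact_add2 M.tact_add3 M.tact_add4 M.tact_add5
        M.tact_zero M.tact_assoc
        N.tact_closed N.tact_add1 N.tact_add2 N.tact_add3 N.tact_add4 N.tact_add5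
        N.tact_zero N.tact_assoc)
qed

text \<open>The algebraic laws are equations quantified over the carrier, so they restrict to any
  subset; only closure has to be supplied.\<close>

lemma subsemimodule:
  assumes "ternary_gamma_semimodule \<Gamma> T M"
    and sub: "S \<subseteq> carrier M" and zero: "\<zero>\<^bsub>M\<^esub> \<in> S"
    and add: "\<And>x y. \<lbrakk>x \<in> S; y \<in> S\<rbrakk> \<Longrightarrow> x \<oplus>\<^bsub>M\<^esub> y \<in> S"
    and act: "\<And>a \<alpha> m \<beta> b. \<lbrakk>a \<in> carrier T; \<alpha> \<in> carrier \<Gamma>; m \<in> S; \<beta> \<in> carrier \<Gamma>; b \<in> carrier T\<rbrakk>
      \<Longrightarrow> tact M a \<alpha> m \<beta> b \<in> S"
  shows "ternary_gamma_semimodule \<Gamma> T (M\<lparr>carrier := S\<rparr>)"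
proof -
  interpret M: ternary_gamma_semimodule \<Gamma> T M by fact
  note sub' = subsetD[OF sub]
  have "comm_monoid (M\<lparr>carrier := S\<rparr>)"
    by (rule comm_monoidI) (auto simp: zero add sub' M.M.m_assoc intro: M.M.m_comm)
  then show ?thesis
    by (intro ternary_gamma_semimodule.intro ternary_gamma_semimodule_axioms.intro
        M.ternary_gamma_semiring_axioms)
      (auto simp: sub' act
        M.tact_add1 M.tact_add2 M.tact_add3 M.tact_add4 M.tact_add5 M.tact_zero M.tact_assoc)
qed

lemma kernel_pair_semimodule:
  assumes M: "ternary_gamma_semimodule \<Gamma> T M" and f: "f \<in> smod_hom \<Gamma> T M N"
  shows "ternary_gamma_semimodule \<Gamma> T (kernel_pair M f)"
proof -
  interpret ternary_gamma_semimodule \<Gamma> T M by fact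
  show ?thesis
    unfolding kernel_pair_def
    by (rule subsemimodule[OF smod_prod_semimodule[OF M M]])
      (auto simp: smod_prod_def smod_homD[OF f] tact_closed)
qed

lemma kernel_pair_projections:
  "proj1 (kernel_pair M f) \<in> smod_hom \<Gamma> T (kernel_pair M f) M"
  "proj2 (kernel_pair M f) \<in> smod_hom \<Gamma> T (kernel_pair M f) M"
  if "ternary_gamma_semimodule \<Gamma> T M" and "f \<in> smod_hom \<Gamma> T M N"
proof -
  interpret K: ternary_gamma_semimodule \<Gamma> T "kernel_pair M f"
    by (rule kernel_pair_semimodule) fact+
  \<comment> \<open>The projections are restricted to the carrier, so evaluating them at a zero, sum
    or action first requires that it lies in the kernel pair.\<close>
  note closed = K.M.one_closed K.M.m_closed K.tact_closed
  show "proj1 (kernel_pair M f) \<in> smod_hom \<Gamma> T (kernel_pair M f) M"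
    "proj2 (kernel_pair M f) \<in> smod_hom \<Gamma> T (kernel_pair M f) M"
    using closed
    by (intro smod_homI; auto simp: proj1_def proj2_def kernel_pair_def smod_prod_def)+
qed

text \<open>The two projections force the mediating map to be the pairing of \<open>u\<close> and
  \<open>v\<close>; the equation between the composites with \<open>f\<close> says precisely that
  this pairing lands in the kernel pair.\<close>

lemma kernel_pair_is_kernel_pair:
  fixes \<Gamma> :: "'g monoid" and T :: "('t, 'g) tsemiring"
  assumes M: "ternary_gamma_semimodule \<Gamma> T M" and N: "ternary_gamma_semimodule \<Gamma> T N"
    and f: "f \<in> smod_hom \<Gamma> T M N"
  shows "is_kernel_pair (TX :: 'x itself) \<Gamma> T M N f (kernel_pair M f)"
proof -
  let ?K = "kernel_pair M f"
  have carrier_K: "carrier ?K = {(x, y) \<in> carrier M \<times> carrier M. f x = f y}"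
    by (simp add: kernel_pair_def)
  have "\<exists>!h. h \<in> smod_hom \<Gamma> T X ?K \<and>
      compose (carrier X) (proj1 ?K) h = u \<and> compose (carrier X) (proj2 ?K) h = v"
    if u: "u \<in> smod_hom \<Gamma> T X M" and v: "v \<in> smod_hom \<Gamma> T X M"
      and eq: "compose (carrier X) f u = compose (carrier X) f v"
      and X: "ternary_gamma_semimodule \<Gamma> T X"
    for X :: "('x, 't, 'g) tsemimodule" and u v
  proof
    interpret X: ternary_gamma_semimodule \<Gamma> T X by fact
    let ?h = "\<lambda>x\<in>carrier X. (u x, v x)"
    have closed: "(u x, v x) \<in> carrier ?K" if "x \<in> carrier X" for x
      using eq that by (simp add: carrier_K compose_eq_compose_iff smod_homD[OF u] smod_homD[OF v])
    have "?h \<in> smod_hom \<Gamma> T X ?K"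
      by (rule smod_homI)
        (auto simp: closed X.tact_closed smod_homD[OF u] smod_homD[OF v],
          auto simp: kernel_pair_def smod_prod_def)
    then show "?h \<in> smod_hom \<Gamma> T X ?K \<and>
        compose (carrier X) (proj1 ?K) ?h = u \<and> compose (carrier X) (proj2 ?K) ?h = v"
      by (simp add: compose_eq_iff smod_homD(3)[OF u] smod_homD(3)[OF v] closed
          proj1_def proj2_def)
    fix h
    assume h: "h \<in> smod_hom \<Gamma> T X ?K \<and>
        compose (carrier X) (proj1 ?K) h = u \<and> compose (carrier X) (proj2 ?K) h = v"
    show "h = ?h"
    proof (rule extensionalityI)
      show "h \<in> extensional (carrier X)" using h by (blast dest: smod_homD(3))
      fix x assume x: "x \<in> carrier X"
      then have "h x \<in> carrier ?K" using h by (blast dest: smod_homD(1))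
      then show "h x = ?h x"
        using h x by (auto simp: compose_eq proj1_def proj2_def prod_eq_iff)
    qed simp
  qed
  moreover have "compose (carrier ?K) f (proj1 ?K) = compose (carrier ?K) f (proj2 ?K)"
    by (auto simp: compose_eq_compose_iff proj1_def proj2_def carrier_K)
  ultimately show ?thesis
    using M N f kernel_pair_semimodule[OF M f] kernel_pair_projections[OF M f]
    unfolding is_kernel_pair_def is_pullback_def by blast
qed

section \<open>Congruences and the quotient semimodule\<close>

locale semimodule_congruence = ternary_gamma_semimodule \<Gamma> T M
  for \<Gamma> :: "'g monoid" and T :: "('t, 'g) tsemiring" and M :: "('m, 't, 'g) tsemimodule" +
  fixes R :: "('m \<times> 'm) set"
  assumes congruence: "smod_congruence \<Gamma> T M R"
begin

lemma equiv: "equiv (carrier M) R"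
  using congruence by (simp add: smod_congruence_def)

lemma rel_carrier: "(x, y) \<in> R \<Longrightarrow> x \<in> carrier M \<and> y \<in> carrier M"
  using equiv_type[OF equiv] by blast

lemma rel_tact:
  "\<lbrakk>a \<in> carrier T; \<alpha> \<in> carrier \<Gamma>; (x, y) \<in> R; \<beta> \<in> carrier \<Gamma>; b \<in> carrier T\<rbrakk>
    \<Longrightarrow> (tact M a \<alpha> x \<beta> b, tact M a \<alpha> y \<beta> b) \<in> R"
  using congruence by (simp add: smod_congruence_def)

text \<open>A congruence allows adding only a common element, so one summand is replaced at a time
  and the two steps are joined by transitivity.\<close>

lemma rel_add:
  assumes "(x, y) \<in> R" and "(x', y') \<in> R"
  shows "(x \<oplus>\<^bsub>M\<^esub> x', y \<oplus>\<^bsub>M\<^esub> y') \<in> R"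
proof -
  have translate: "(u \<oplus>\<^bsub>M\<^esub> z, v \<oplus>\<^bsub>M\<^esub> z) \<in> R" if "(u, v) \<in> R" "z \<in> carrier M" for u v z
    using congruence that by (simp add: smod_congruence_def)
  have "(x \<oplus>\<^bsub>M\<^esub> x', y \<oplus>\<^bsub>M\<^esub> x') \<in> R"
    using assms rel_carrier translate by blast
  \<comment> \<open>Translation acts on the right; commutativity moves \<open>y\<close> to the
    left.\<close>
  moreover have "(y \<oplus>\<^bsub>M\<^esub> x', y \<oplus>\<^bsub>M\<^esub> y') \<in> R"
    using translate[OF assms(2), of y] assms rel_carrier by (simp add: M.m_comm)
  ultimately show ?thesis
    using equiv by (meson equivE transD)
qed

abbreviation cls :: "'m \<Rightarrow> 'm set"
  where "cls x \<equiv> R `` {x}"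

lemma cls_eq: "(x, y) \<in> R \<Longrightarrow> cls x = cls y"
  by (rule equiv_class_eq[OF equiv])

lemma cls_eq_iff:
  "\<lbrakk>x \<in> carrier M; y \<in> carrier M\<rbrakk> \<Longrightarrow> cls x = cls y \<longleftrightarrow> (x, y) \<in> R"
  by (rule eq_equiv_class_iff[OF equiv])

lemma cls_self: "x \<in> carrier M \<Longrightarrow> x \<in> cls x"
  by (rule equiv_class_self[OF equiv])

lemma quot_carrier: "carrier (smod_quot M R) = cls ` carrier M"
  by (auto simp: smod_quot_def quotient_def)

lemma quot_zero: "\<zero>\<^bsub>smod_quot M R\<^esub> = cls \<zero>\<^bsub>M\<^esub>"
  by (simp add: smod_quot_def)

text \<open>By \<open>rel_add\<close> all classes in the defining union coincide, and the index sets
  are inhabited by \<open>x\<close> and \<open>y\<close> themselves, so the union is that one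
  class.\<close>

lemma quot_add:
  assumes "x \<in> carrier M" and "y \<in> carrier M"
  shows "cls x \<oplus>\<^bsub>smod_quot M R\<^esub> cls y = cls (x \<oplus>\<^bsub>M\<^esub> y)"
proof -
  have eq: "cls (x' \<oplus>\<^bsub>M\<^esub> y') = cls (x \<oplus>\<^bsub>M\<^esub> y)" if "x' \<in> cls x" "y' \<in> cls y" for x' y'
    using that rel_add cls_eq by (metis Image_singleton_iff)
  have "(\<Union>x'\<in>cls x. \<Union>y'\<in>cls y. cls (x' \<oplus>\<^bsub>M\<^esub> y')) = cls (x \<oplus>\<^bsub>M\<^esub> y)"
    by (intro UN_constant_eq[OF cls_self[OF assms(1)]] UN_constant_eq[OF cls_self[OF assms(2)]]
        ballI eq)
  then show ?thesis
    by (simp only: smod_quot_def monoid.simps)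
qed

lemma quot_tact:
  assumes "a \<in> carrier T" and "\<alpha> \<in> carrier \<Gamma>" and "x \<in> carrier M"
    and "\<beta> \<in> carrier \<Gamma>" and "b \<in> carrier T"
  shows "tact (smod_quot M R) a \<alpha> (cls x) \<beta> b = cls (tact M a \<alpha> x \<beta> b)"
proof -
  have "cls (tact M a \<alpha> x' \<beta> b) = cls (tact M a \<alpha> x \<beta> b)" if "x' \<in> cls x" for x'
    using that rel_tact assms cls_eq by (metis Image_singleton_iff)
  with cls_self[OF assms(3)] have "(\<Union>x'\<in>cls x. cls (tact M a \<alpha> x' \<beta> b)) = cls (tact M a \<alpha> x \<beta> b)"
    by (intro UN_constant_eq ballI)
  then show ?thesis
    by (simp only: smod_quot_def tsemimodule.simps)
qed

lemma quot_semimodule: "ternary_gamma_semimodule \<Gamma> T (smod_quot M R)"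
proof -
  have "comm_monoid (smod_quot M R)"
    by (rule comm_monoidI)
      (auto simp: quot_carrier quot_zero quot_add M.m_ac)
  moreover have "tact (smod_quot M R) a \<alpha> X \<beta> b = \<zero>\<^bsub>smod_quot M R\<^esub>"
    if X: "X \<in> carrier (smod_quot M R)"
      and abc: "a \<in> carrier T" "\<alpha> \<in> carrier \<Gamma>" "\<beta> \<in> carrier \<Gamma>" "b \<in> carrier T"
      and zero: "a = \<zero>\<^bsub>T\<^esub> \<or> X = \<zero>\<^bsub>smod_quot M R\<^esub> \<or> b = \<zero>\<^bsub>T\<^esub> \<or> \<alpha> = \<zero>\<^bsub>\<Gamma>\<^esub> \<or> \<beta> = \<zero>\<^bsub>\<Gamma>\<^esub>"
    for a \<alpha> X \<beta> b
  proof -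
    \<comment> \<open>If \<open>X\<close> is the zero class, the representative must be chosen to be
      zero itself, since other members of that class need not be zero.\<close>
    obtain x where x: "x \<in> carrier M" "X = cls x"
      and "a = \<zero>\<^bsub>T\<^esub> \<or> x = \<zero>\<^bsub>M\<^esub> \<or> b = \<zero>\<^bsub>T\<^esub> \<or> \<alpha> = \<zero>\<^bsub>\<Gamma>\<^esub> \<or> \<beta> = \<zero>\<^bsub>\<Gamma>\<^esub>"
      using X zero M.one_closed unfolding quot_carrier quot_zero by blast
    then have "tact M a \<alpha> x \<beta> b = \<zero>\<^bsub>M\<^esub>"
      using abc by (intro tact_zero)
    then show ?thesis
      using x abc by (simp add: quot_tact quot_zero)
  qed
  ultimately show ?thesis
    by (intro ternary_gamma_semimodule.intro ternary_gamma_semimodule_axioms.intro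
        ternary_gamma_semiring_axioms)
      (auto simp: quot_carrier quot_add quot_tact tact_closed tmul_closed
        tact_add1 tact_add2 tact_add3 tact_add4 tact_add5 tact_assoc)
qed

lemma quot_map_apply: "x \<in> carrier M \<Longrightarrow> quot_map M R x = cls x"
  by (simp add: quot_map_def)

lemma quot_map_hom: "quot_map M R \<in> smod_hom \<Gamma> T M (smod_quot M R)"
  by (rule smod_homI)
    (auto simp: quot_map_apply quot_carrier quot_add quot_zero quot_tact tact_closed,
      simp add: quot_map_def)

section \<open>Universal properties of the quotient map\<close>

text \<open>Both sides are \<open>smod_prod M M\<close> with the carrier replaced, so comparing
  carriers suffices.\<close>

lemma kernel_pair_quot_map: "kernel_pair M (quot_map M R) = rel_smod M R"
proof -
  have "quot_map M R x = quot_map M R y \<longleftrightarrow> (x, y) \<in> R"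
    if "x \<in> carrier M" "y \<in> carrier M" for x y
    using that by (simp only: quot_map_apply cls_eq_iff)
  then have "{(x, y) \<in> carrier M \<times> carrier M. quot_map M R x = quot_map M R y} = R"
    using rel_carrier by blast
  then show ?thesis
    by (simp add: kernel_pair_def rel_smod_def)
qed

lemma quot_map_coequalizer:
  "is_coequalizer (TX :: 'x itself) \<Gamma> T (rel_smod M R) M (proj1 (rel_smod M R)) (proj2 (rel_smod M R))
    (smod_quot M R) (quot_map M R)"
proof -
  let ?E = "rel_smod M R" and ?Q = "smod_quot M R" and ?q = "quot_map M R"
  \<comment> \<open>The codomain type stays free because the criterion serves both \<open>?q\<close>
    and the test morphisms.\<close>
  have compose_eq_iff_rel: "compose (carrier ?E) h (proj1 ?E) = compose (carrier ?E) h (proj2 ?E)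
      \<longleftrightarrow> (\<forall>(x, y)\<in>R. h x = h y)" for h :: "'m \<Rightarrow> 'z"
    by (auto simp: compose_eq_compose_iff proj1_def proj2_def rel_smod_def)
  have "\<exists>!k. k \<in> smod_hom \<Gamma> T ?Q X \<and> compose (carrier M) k ?q = h"
    if h: "h \<in> smod_hom \<Gamma> T M X" and const: "\<forall>(x, y)\<in>R. h x = h y"
    for X :: "('x, 't, 'g) tsemimodule" and h
  proof
    \<comment> \<open>Since \<open>h\<close> is constant on each class, the image of a class is a
      singleton, and its element is the value; no representative is chosen.\<close>
    let ?k = "\<lambda>C\<in>carrier ?Q. the_elem (h ` C)"
    have k_cls: "?k (cls x) = h x" if x: "x \<in> carrier M" for x
    proof -
      have "h ` cls x = {h x}"
        using const cls_self[OF x] by fastforce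
      then show ?thesis
        using x by (simp add: quot_carrier)
    qed
    have "?k \<in> smod_hom \<Gamma> T ?Q X"
    proof (rule smod_homI)
      show "?k \<zero>\<^bsub>?Q\<^esub> = \<zero>\<^bsub>X\<^esub>"
        by (simp only: quot_zero k_cls[OF M.one_closed] smod_homD(4)[OF h])
    next
      fix C assume "C \<in> carrier ?Q"
      then obtain x where x: "x \<in> carrier M" "C = cls x" by (auto simp: quot_carrier)
      then show "?k C \<in> carrier X"
        by (simp only: k_cls smod_homD(1)[OF h])
    next
      fix C D assume "C \<in> carrier ?Q" "D \<in> carrier ?Q"
      then obtain x y where "x \<in> carrier M" "C = cls x" "y \<in> carrier M" "D = cls y"
        by (auto simp: quot_carrier)
      then show "?k (C \<oplus>\<^bsub>?Q\<^esub> D) = ?k C \<oplus>\<^bsub>X\<^esub> ?k D"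
        by (simp only: quot_add k_cls M.m_closed smod_homD(2)[OF h])
    next
      fix a \<alpha> C \<beta> b
      assume abc: "a \<in> carrier T" "\<alpha> \<in> carrier \<Gamma>" "\<beta> \<in> carrier \<Gamma>" "b \<in> carrier T"
        and "C \<in> carrier ?Q"
      then obtain x where "x \<in> carrier M" "C = cls x" by (auto simp: quot_carrier)
      then show "?k (tact ?Q a \<alpha> C \<beta> b) = tact X a \<alpha> (?k C) \<beta> b"
        using abc by (simp only: quot_tact k_cls tact_closed smod_homD(5)[OF h])
    qed simp
    moreover have "compose (carrier M) ?k ?q = h"
      unfolding compose_eq_iff[OF smod_homD(3)[OF h]]
      by (intro ballI) (simp only: quot_map_apply k_cls)
    ultimately show "?k \<in> smod_hom \<Gamma> T ?Q X \<and> compose (carrier M) ?k ?q = h" ..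
    fix k assume k: "k \<in> smod_hom \<Gamma> T ?Q X \<and> compose (carrier M) k ?q = h"
    show "k = ?k"
    proof (rule extensionalityI)
      show "k \<in> extensional (carrier ?Q)" using k by (blast dest: smod_homD(3))
      fix C assume "C \<in> carrier ?Q"
      then obtain x where x: "x \<in> carrier M" "C = cls x" by (auto simp: quot_carrier)
      \<comment> \<open>Uniqueness is surjectivity of \<open>?q\<close>: \<open>C\<close> is the
        image of \<open>x\<close>, so the factorization fixes the value of \<open>k\<close>
        there.\<close>
      then have "k C = h x" using k by (auto simp: compose_eq quot_map_apply)
      then show "k C = ?k C" using x by (simp only: k_cls)
    qed simp
  qed
  moreover have "\<forall>(x, y)\<in>R. ?q x = ?q y"
    using rel_carrier cls_eq by (force simp only: quot_map_apply)
  ultimately show ?thesis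
    using ternary_gamma_semimodule_axioms quot_semimodule quot_map_hom
      \<comment> \<open>Rewriting with \<open>kernel_pair_quot_map\<close> turns these facts into
        statements about \<open>?E\<close>: it is a semimodule and its projections are
        morphisms.\<close>
      kernel_pair_semimodule[OF ternary_gamma_semimodule_axioms quot_map_hom]
      kernel_pair_projections[OF ternary_gamma_semimodule_axioms quot_map_hom]
    unfolding is_coequalizer_def kernel_pair_quot_map compose_eq_iff_rel by blast
qed

lemma quot_map_kernel_pair:
  "is_kernel_pair TX \<Gamma> T M (smod_quot M R) (quot_map M R) (kernel_pair M (quot_map M R))"
  by (intro kernel_pair_is_kernel_pair ternary_gamma_semimodule_axioms quot_semimodule quot_map_hom)

lemma congruence_effective: "effective TX TY \<Gamma> T M R"
  by (simp add: effective_def congruence quot_map_coequalizer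
      quot_map_kernel_pair[unfolded kernel_pair_quot_map])

end

theorem proposition8p6:
  fixes \<Gamma> :: "'g monoid" and T :: "('t, 'g) tsemiring"
    and M :: "('m, 't, 'g) tsemimodule" and R :: "('m \<times> 'm) set"
  assumes "ternary_gamma_semiring \<Gamma> T"
    and "ternary_gamma_semimodule \<Gamma> T M"
    and "smod_congruence \<Gamma> T M R"
  shows "is_kernel_pair TYPE('x) \<Gamma> T M (smod_quot M R) (quot_map M R)
           (kernel_pair M (quot_map M R))
       \<and> kernel_pair M (quot_map M R) = rel_smod M R
       \<and> effective TYPE('y) TYPE('z) \<Gamma> T M R"
proof -
  interpret semimodule_congruence \<Gamma> T M R
    using assms(2,3) by (simp add: semimodule_congruence_def semimodule_congruence_axioms_def)
  show ?thesis
    by (intro conjI quot_map_kernel_pair kernel_pair_quot_map congruence_effective)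
qed

end
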